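(* For every $f\in L^1(\mathbb{H})$ and every integer $n\geq 2$, $$\int_{\mathbb{R}^3}f(x,y,t)\,\phi_n(x,y,t)\,dx\,dy\,dt=\frac{1}{(\sqrt{2})^n}\int_{Q^n}\big(R_{(x_2,y_2,t_2)}\cdots R_{(x_n,y_n,t_n)}f\big)(x_1,y_1,t_1)\,(dx_1\cdots dx_n)(dy_1\cdots dy_n)(dt_1\cdots dt_n),$$ where $Q=[0,2]\times[0,1]\times[0,1]$, the integration variables satisfy $(x_i,y_i,t_i)\in Q$ for $i=1,\dots,n$, $\phi_n$ is the $n$-th order $B$-spline on the Heisenberg group $\mathbb{H}$, and $R_{(u,v,s)}$ denotes right translation on $\mathbb{H}$.
   Context: The Heisenberg group $\mathbb{H}$ is $\mathbb{R}^3$ with the group law $(x,y,t)(x',y',t')=(x+x',\,y+y',\,t+t'+\tfrac12(x'y-y'x))$, so that $(x,y,t)^{-1}=(-x,-y,-t)$; Haar measure is Lebesgue measure $dx\,dy\,dt$ on $\mathbb{R}^3$, and $L^p(\mathbb{H})$ is taken with respect to it. For $f,g\in L^1(\mathbb{H})$, the convolution is $(f*g)(x,y,t)=\int_{\mathbb{H}}f\big((x,y,t)(u,v,s)^{-1}\big)g(u,v,s)\,du\,dv\,ds$. The $B$-splines on $\mathbb{H}$ are $\phi_1=\frac{1}{\sqrt2}\chi_{[0,2]\times[0,1]\times[0,1]}$ and $\phi_{n+1}=\phi_n*\phi_1$ for $n\ge1$ (so $\phi_n$ is the $n$-fold convolution of $\phi_1$). For $(u,v,s)\in\mathbb{H}$,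 the right translation operator is $(R_{(u,v,s)}f)(x,y,t)=f\big((x,y,t)(u,v,s)\big)$. *)

theory Defs
  imports "HOL-Analysis.Analysis"
begin

type_synonym heis = "real \<times> real \<times> real"

fun hmult :: "heis \<Rightarrow> heis \<Rightarrow> heis"  (infixl "\<cdot>\<^sub>H" 70) where
  "(x, y, t) \<cdot>\<^sub>H (x', y', t') = (x + x', y + y', t + t' + (x' * y - y' * x) / 2)"

fun hinv :: "heis \<Rightarrow> heis" where
  "hinv (x, y, t) = (- x, - y, - t)"

lemma hmult_assoc: "(a \<cdot>\<^sub>H b) \<cdot>\<^sub>H c = a \<cdot>\<^sub>H (b \<cdot>\<^sub>H c)"
  by (cases a; cases b; cases c) (simp add: field_simps)

lemma hmult_zero: "a \<cdot>\<^sub>H (0, 0, 0) = a" "(0, 0, 0) \<cdot>\<^sub>H a = a"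
  by (cases a; simp)+

lemma hmult_hinv: "a \<cdot>\<^sub>H hinv a = (0, 0, 0)" "hinv a \<cdot>\<^sub>H a = (0, 0, 0)"
  by (cases a; simp)+

definition hconv :: "(heis \<Rightarrow> complex) \<Rightarrow> (heis \<Rightarrow> complex) \<Rightarrow> heis \<Rightarrow> complex" where
  "hconv f g z = (LINT w|lebesgue. f (z \<cdot>\<^sub>H hinv w) * g w)"

definition Qbox :: "heis set" where
  "Qbox = {0..2} \<times> {0..1} \<times> {0..1}"

definition bspline1 :: "heis \<Rightarrow> complex" where
  "bspline1 z = complex_of_real (1 / sqrt 2) * indicator Qbox z"

text \<open>The order of a B-spline is at least 1; the value at order 0 is a dummy.\<close>

fun bspline :: "nat \<Rightarrow> heis \<Rightarrow> complex" where
  "bspline 0 = (\<lambda>_. 0)"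
| "bspline (Suc 0) = bspline1"
| "bspline (Suc (Suc n)) = hconv (bspline (Suc n)) bspline1"

definition rtrans :: "heis \<Rightarrow> (heis \<Rightarrow> complex) \<Rightarrow> heis \<Rightarrow> complex" where
  "rtrans w f z = f (z \<cdot>\<^sub>H w)"

text \<open>Lebesgue measure on the \<open>n\<close>-fold power of \<open>\<real>\<^sup>3\<close>, with points
  given as families indexed by \<open>{1..n}\<close>.  The completion is needed because \<open>f\<close> is only
  Lebesgue measurable, so that its composition with a product of group elements need not be
  measurable for the product sigma-algebra itself.\<close>

definition lebesgue_power :: "nat \<Rightarrow> (nat \<Rightarrow> heis) measure" where
  "lebesgue_power n = completion (PiM {1..n} (\<lambda>_. lborel))"

definition Qpower :: "nat \<Rightarrow> (nat \<Rightarrow> heis) set" where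
  "Qpower n = (\<Pi>\<^sub>E i\<in>{1..n}. Qbox)"

text \<open>The composite \<open>R\<^bsub>z 2\<^esub> (\<dots> (R\<^bsub>z n\<^esub> f))\<close>, where \<open>R\<close> is right translation.\<close>

definition iter_rtrans :: "nat \<Rightarrow> (nat \<Rightarrow> heis) \<Rightarrow> (heis \<Rightarrow> complex) \<Rightarrow> heis \<Rightarrow> complex" where
  "iter_rtrans n z f = foldr (\<lambda>i. rtrans (z i)) [2..<Suc n] f"

end

(* The push-forward of Lebesgue measure on Q^n under (z_1, ..., z_n) |-> z_1 ... z_n has density
   sqrt 2 ^ n * phi_n. This follows by induction on n from Tonelli and the invariance of Lebesgue
   measure under right translations. Since R_{z_2} ... R_{z_n} f (z_1) = f (z_1 ... z_n), the
   formula holds for Borel functions f. A Lebesgue measurable f agrees with a Borel function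
   outside a Borel null set, whose preimage in Q^n is again null because the push-forward is
   absolutely continuous. *)
theory Submission imports Defs begin

section \<open>Haar measure\<close>

text \<open>Written with projections, the product is a visibly polynomial function of the
  coordinates, so the continuity rules apply and yield Borel measurability.\<close>

lemma hmult_eq:
  "a \<cdot>\<^sub>H b = (fst a + fst b, fst (snd a) + fst (snd b),
     snd (snd a) + snd (snd b) + (fst b * fst (snd a) - fst (snd b) * fst a) / 2)"
  by (cases a; cases b) simp

lemma hinv_eq: "hinv a = (- fst a, - fst (snd a), - snd (snd a))"
  by (cases a) simp

lemma borel_measurable_hmult [measurable (raw)]:
  assumes [measurable]: "f \<in> borel_measurable M" "g \<in> borel_measurable M"
  shows "(\<lambda>x. f x \<cdot>\<^sub>H g x) \<in> borel_measurable M"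
  by (rule borel_measurable_continuous_Pair[OF assms])
     (unfold hmult_eq, intro continuous_intros, simp)

lemma borel_measurable_hinv [measurable (raw)]:
  assumes [measurable]: "f \<in> borel_measurable M"
  shows "(\<lambda>x. hinv (f x)) \<in> borel_measurable M"
  by (rule borel_measurable_continuous_on[OF _ assms])
     (unfold hinv_eq, intro continuous_intros)

text \<open>Tonelli applied twice. The coordinate \<open>t\<close> is placed innermost, as the shear
  in the group law requires below.\<close>

lemma nn_integral_lborel_heis:
  fixes h :: "heis \<Rightarrow> ennreal"
  assumes [measurable]: "h \<in> borel_measurable borel"
  shows "(\<integral>\<^sup>+p. h p \<partial>lborel) = (\<integral>\<^sup>+x. \<integral>\<^sup>+y. \<integral>\<^sup>+t. h (x, y, t) \<partial>lborel \<partial>lborel \<partial>lborel)"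
proof -
  have "(\<integral>\<^sup>+p. h p \<partial>lborel) = (\<integral>\<^sup>+p. h p \<partial>(lborel \<Otimes>\<^sub>M lborel))"
    by (simp add: lborel_prod)
  also have "\<dots> = (\<integral>\<^sup>+x. \<integral>\<^sup>+q. h (x, q) \<partial>lborel \<partial>lborel)"
    by (rule lborel.nn_integral_fst[symmetric]) (simp add: lborel_prod)
  also have "\<dots> = (\<integral>\<^sup>+x. \<integral>\<^sup>+q. h (x, q) \<partial>(lborel \<Otimes>\<^sub>M lborel) \<partial>lborel)"
    by (simp add: lborel_prod)
  also have "\<dots> = (\<integral>\<^sup>+x. \<integral>\<^sup>+y. \<integral>\<^sup>+t. h (x, y, t) \<partial>lborel \<partial>lborel \<partial>lborel)"
    by (intro nn_integral_cong lborel.nn_integral_fst[symmetric]) (simp add: lborel_prod)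
  finally show ?thesis .
qed

lemma nn_integral_lborel_translate:
  fixes h :: "real \<Rightarrow> ennreal"
  assumes [measurable]: "h \<in> borel_measurable borel"
  shows "(\<integral>\<^sup>+x. h (x + c) \<partial>lborel) = (\<integral>\<^sup>+x. h x \<partial>lborel)"
  using nn_integral_real_affine[of h 1 c] by (simp add: add.commute)

text \<open>Right multiplication by \<open>w\<close> shifts \<open>x\<close> and \<open>y\<close> by
  constants and \<open>t\<close> by an amount depending only on \<open>x\<close> and
  \<open>y\<close>. Integrating \<open>t\<close> first therefore reduces everything to translations
  of the line.\<close>

lemma nn_integral_right_translate:
  assumes [measurable]: "h \<in> borel_measurable borel"
  shows "(\<integral>\<^sup>+p. h (p \<cdot>\<^sub>H w) \<partial>lborel) = (\<integral>\<^sup>+p. h p \<partial>lborel)"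
proof -
  obtain a b c where w: "w = (a, b, c)" by (cases w)
  have "(\<integral>\<^sup>+p. h (p \<cdot>\<^sub>H w) \<partial>lborel) =
      (\<integral>\<^sup>+x. \<integral>\<^sup>+y. \<integral>\<^sup>+t. h (x + a, y + b, t + (c + (a * y - b * x) / 2))
        \<partial>lborel \<partial>lborel \<partial>lborel)"
    by (subst nn_integral_lborel_heis) (simp_all add: w add.assoc)
  also have "\<dots> = (\<integral>\<^sup>+x. \<integral>\<^sup>+y. \<integral>\<^sup>+t. h (x + a, y + b, t) \<partial>lborel \<partial>lborel \<partial>lborel)"
    by (intro nn_integral_cong nn_integral_lborel_translate) measurable
  also have "\<dots> = (\<integral>\<^sup>+x. \<integral>\<^sup>+y. \<integral>\<^sup>+t. h (x + a, y, t) \<partial>lborel \<partial>lborel \<partial>lborel)"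
    by (intro nn_integral_cong nn_integral_lborel_translate
          [where h = "\<lambda>y. \<integral>\<^sup>+t. h (_ + a, y, t) \<partial>lborel"]) measurable
  also have "\<dots> = (\<integral>\<^sup>+x. \<integral>\<^sup>+y. \<integral>\<^sup>+t. h (x, y, t) \<partial>lborel \<partial>lborel \<partial>lborel)"
    by (rule nn_integral_lborel_translate
          [where h = "\<lambda>x. \<integral>\<^sup>+y. \<integral>\<^sup>+t. h (x, y, t) \<partial>lborel \<partial>lborel"]) measurable
  finally show ?thesis by (simp add: nn_integral_lborel_heis)
qed

section \<open>Splines as real functions\<close>

lemma Qbox_cbox: "Qbox = cbox (0, 0, 0) (2, 1, 1)"
  by (simp add: Qbox_def cbox_Pair_eq)

lemma Qbox_measurable [measurable]: "Qbox \<in> sets borel"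
  by (simp add: Qbox_cbox)

lemma emeasure_lborel_Times:
  fixes A :: "'a::euclidean_space set" and B :: "'b::euclidean_space set"
  assumes "A \<in> sets borel" "B \<in> sets borel"
  shows "emeasure lborel (A \<times> B) = emeasure lborel A * emeasure lborel B"
  using lborel.emeasure_pair_measure_Times[of A lborel B] assms by (simp add: lborel_prod)

lemma emeasure_Qbox: "emeasure lborel Qbox = 2"
  by (simp add: Qbox_def emeasure_lborel_Times borel_closed closed_Times)

text \<open>The splines are real and nonnegative, so passing to the real part loses nothing and
  makes \<open>ennreal\<close> integrals and Tonelli available.\<close>

definition real_bspline :: "nat \<Rightarrow> heis \<Rightarrow> real" where
  "real_bspline n p = Re (bspline n p)"

text \<open>The integrand is dominated by a multiple of the indicator of \<open>Qbox\<close>, which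
  has finite measure. It is also Borel, so \<open>lebesgue\<close> may be replaced by
  \<open>lborel\<close>.\<close>

lemma hconv_bspline1:
  assumes [measurable]: "g \<in> borel_measurable borel"
    and g: "\<And>p. 0 \<le> g p" "\<And>p. g p \<le> C"
  shows "integrable lborel (\<lambda>w. g (p \<cdot>\<^sub>H hinv w) * (indicator Qbox w / sqrt 2))"
    and "hconv (\<lambda>p. complex_of_real (g p)) bspline1 p =
      complex_of_real (LINT w|lborel. g (p \<cdot>\<^sub>H hinv w) * (indicator Qbox w / sqrt 2))"
proof -
  let ?F = "\<lambda>w. g (p \<cdot>\<^sub>H hinv w) * (indicator Qbox w / sqrt 2)"
  have C: "0 \<le> C" using g[of p] by linarith
  have "integrable lborel (\<lambda>w. C * (indicator Qbox w / sqrt 2))"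
    using emeasure_Qbox by simp
  then show "integrable lborel ?F"
  proof (rule Bochner_Integration.integrable_bound)
    show "AE w in lborel. norm (?F w) \<le> norm (C * (indicator Qbox w / sqrt 2))"
      by (intro AE_I2) (simp add: g C abs_mult divide_right_mono mult_right_mono)
  qed measurable
  have "hconv (\<lambda>p. complex_of_real (g p)) bspline1 p = (LINT w|lebesgue. complex_of_real (?F w))"
    unfolding hconv_def
    by (intro Bochner_Integration.integral_cong) (auto simp: bspline1_def indicator_def)
  also have "\<dots> = (LINT w|lborel. complex_of_real (?F w))"
    by (rule integral_completion) measurable
  finally show "hconv (\<lambda>p. complex_of_real (g p)) bspline1 p = complex_of_real (LINT w|lborel. ?F w)"
    by (simp only: integral_complex_of_real)
qed

text \<open>The properties are proved jointly because \<open>hconv_bspline1\<close> needs all of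
  them at order \<open>n\<close> to control order \<open>Suc n\<close>. The bound passes on since
  \<open>bspline1\<close> has finite integral.\<close>

lemma bspline_real_bounded:
  assumes "1 \<le> n"
  shows "real_bspline n \<in> borel_measurable borel \<and>
    bspline n = (\<lambda>p. complex_of_real (real_bspline n p)) \<and>
    (\<forall>p. 0 \<le> real_bspline n p) \<and> (\<exists>C. \<forall>p. real_bspline n p \<le> C)"
  using assms
proof (induction n rule: dec_induct)
  case base
  have eq: "real_bspline 1 = (\<lambda>p. indicator Qbox p / sqrt 2)"
    by (auto simp: real_bspline_def bspline1_def indicator_def fun_eq_iff)
  show ?case unfolding eq
    by (intro conjI exI[of _ "1 / sqrt 2"])
       (auto simp: bspline1_def fun_eq_iff indicator_def)
next
  case (step n)
  let ?F = "\<lambda>p w. real_bspline n (p \<cdot>\<^sub>H hinv w) * (indicator Qbox w / sqrt 2)"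
  from step.IH obtain C where [measurable]: "real_bspline n \<in> borel_measurable borel"
    and b: "bspline n = (\<lambda>p. complex_of_real (real_bspline n p))"
    and g: "\<And>p. 0 \<le> real_bspline n p" "\<And>p. real_bspline n p \<le> C" by blast
  \<comment> \<open>The convolution recursion starts from order 1, order 0 being a dummy, so
    \<open>n\<close> has to be exposed as a successor.\<close>
  have suc: "bspline (Suc n) = hconv (bspline n) bspline1"
    using step.hyps by (cases n) auto
  have B: "bspline (Suc n) p = complex_of_real (LINT w|lborel. ?F p w)" for p
    unfolding suc by (subst b) (rule hconv_bspline1(2)[OF _ g], measurable)
  then have R: "real_bspline (Suc n) = (\<lambda>p. LINT w|lborel. ?F p w)"
    by (simp add: real_bspline_def fun_eq_iff)
  have le: "(LINT w|lborel. ?F p w) \<le> (LINT w|lborel. C * (indicator Qbox w / sqrt 2))" for p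
  proof (rule integral_mono)
    show "integrable lborel (\<lambda>w. ?F p w)" by (rule hconv_bspline1(1)[OF _ g]) measurable
    show "integrable lborel (\<lambda>w. C * (indicator Qbox w / sqrt 2))" using emeasure_Qbox by simp
  qed (simp add: g divide_right_mono mult_right_mono)
  show ?case unfolding R
  proof (intro conjI)
    show "(\<lambda>p. LINT w|lborel. ?F p w) \<in> borel_measurable borel"
      by (rule lborel.borel_measurable_lebesgue_integral) measurable
  qed (use B g le in \<open>auto simp: fun_eq_iff intro!: integral_nonneg_AE\<close>)
qed

lemma real_bspline_measurable [measurable]: "real_bspline n \<in> borel_measurable borel"
proof (cases n)
  case 0
  then have "real_bspline n = (\<lambda>_. 0)" by (simp add: real_bspline_def fun_eq_iff)
  then show ?thesis by simp
qed (simp add: bspline_real_bounded)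

lemma bspline_eq_real: "1 \<le> n \<Longrightarrow> bspline n p = complex_of_real (real_bspline n p)"
  using bspline_real_bounded by metis

lemma real_bspline_nonneg: "1 \<le> n \<Longrightarrow> 0 \<le> real_bspline n p"
  using bspline_real_bounded by blast

lemma real_bspline_bounded: "1 \<le> n \<Longrightarrow> \<exists>C. \<forall>p. real_bspline n p \<le> C"
  using bspline_real_bounded by blast

lemma real_bspline_1: "real_bspline (Suc 0) p = indicator Qbox p / sqrt 2"
  by (auto simp: real_bspline_def bspline1_def indicator_def)

text \<open>This is the convolution recursion in the form that Tonelli can use: the integrand is
  nonnegative and integrable, so its Bochner integral is a nonnegative integral.\<close>

lemma real_bspline_Suc:
  assumes "1 \<le> n"
  shows "ennreal (real_bspline (Suc n) p) =
    (\<integral>\<^sup>+w. ennreal (real_bspline n (p \<cdot>\<^sub>H hinv w)) * (ennreal (1 / sqrt 2) * indicator Qbox w) \<partial>lborel)"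
proof -
  obtain C where C: "\<And>p. real_bspline n p \<le> C" using real_bspline_bounded[OF assms] by blast
  note g = real_bspline_measurable real_bspline_nonneg[OF assms] C
  have "bspline n = (\<lambda>p. complex_of_real (real_bspline n p))"
    using bspline_eq_real[OF assms] by auto
  moreover have "bspline (Suc n) = hconv (bspline n) bspline1"
    using assms by (cases n) auto
  ultimately have "real_bspline (Suc n) p =
      (LINT w|lborel. real_bspline n (p \<cdot>\<^sub>H hinv w) * (indicator Qbox w / sqrt 2))"
    using hconv_bspline1(2)[OF g, of p] by (simp add: real_bspline_def)
  also have "ennreal \<dots> =
      (\<integral>\<^sup>+w. ennreal (real_bspline n (p \<cdot>\<^sub>H hinv w) * (indicator Qbox w / sqrt 2)) \<partial>lborel)"
    using hconv_bspline1(1)[OF g, of p] g(2)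
    by (intro nn_integral_eq_integral[symmetric]) auto
  also have "\<dots> = (\<integral>\<^sup>+w. ennreal (real_bspline n (p \<cdot>\<^sub>H hinv w)) *
      (ennreal (1 / sqrt 2) * indicator Qbox w) \<partial>lborel)"
    by (intro nn_integral_cong) (simp add: indicator_def ennreal_mult'[symmetric] g(2))
  finally show ?thesis .
qed

section \<open>The product map on powers of the box\<close>

primrec hprod :: "nat \<Rightarrow> (nat \<Rightarrow> heis) \<Rightarrow> heis" where
  "hprod 0 z = (0, 0, 0)"
| "hprod (Suc n) z = hprod n z \<cdot>\<^sub>H z (Suc n)"

lemma hprod_cong: "(\<And>i. i \<in> {1..n} \<Longrightarrow> z i = z' i) \<Longrightarrow> hprod n z = hprod n z'"
  by (induction n) auto

text \<open>The operator with the largest index acts on \<open>f\<close> first, so the induction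
  hypothesis is used for \<open>rtrans (z (Suc n)) f\<close>; this is why \<open>f\<close> is
  generalised. Evaluating that translate at \<open>hprod n z\<close> appends the last factor on the
  right.\<close>

lemma iter_rtrans_eq_hprod:
  assumes "1 \<le> n"
  shows "iter_rtrans n z f (z 1) = f (hprod n z)"
  using assms
proof (induction n arbitrary: f rule: dec_induct)
  case base
  show ?case by (simp add: iter_rtrans_def hmult_zero)
next
  case (step n)
  have "iter_rtrans (Suc n) z f = iter_rtrans n z (rtrans (z (Suc n)) f)"
    using step.hyps by (simp add: iter_rtrans_def)
  then have "iter_rtrans (Suc n) z f (z 1) = rtrans (z (Suc n)) f (hprod n z)"
    by (simp only: step.IH)
  then show ?case by (simp add: rtrans_def)
qed

text \<open>The index set \<open>I\<close> may exceed \<open>{1..n}\<close> so that the product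
  space stays fixed while the induction adds factors.\<close>

lemma hprod_measurable [measurable]:
  "{1..n} \<subseteq> I \<Longrightarrow> hprod n \<in> borel_measurable (PiM I (\<lambda>_. lborel))"
proof (induction n)
  case (Suc n)
  then have "(\<lambda>z. z (Suc n) :: heis) \<in> borel_measurable (PiM I (\<lambda>_. lborel))"
    using measurable_component_singleton[of "Suc n" I "\<lambda>_. lborel"] subsetD[OF Suc.prems, of "Suc n"]
    by simp
  moreover have "hprod n \<in> borel_measurable (PiM I (\<lambda>_. lborel))"
    by (rule Suc.IH) (use Suc.prems in auto)
  ultimately show ?case by simp
qed (simp add: hprod_def)

lemma Qpower_sets [measurable]: "Qpower n \<in> sets (PiM {1..n} (\<lambda>_. lborel))"
  unfolding Qpower_def by (rule sets_PiM_I_finite) auto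

text \<open>The update erases the value of \<open>z\<close> at \<open>Suc n\<close>. For
  \<open>z\<close> in the product space that value is \<open>undefined\<close>, which is what
  membership in \<open>Qpower n\<close> demands.\<close>

lemma indicator_Qpower_Suc:
  assumes "z \<in> space (PiM {1..n} (\<lambda>_. lborel))"
  shows "(indicator (Qpower (Suc n)) (z(Suc n := w)) :: ennreal) =
    indicator (Qpower n) z * indicator Qbox w"
proof -
  have "z(Suc n := w) \<in> Qpower (Suc n) \<longleftrightarrow> z \<in> Qpower n \<and> w \<in> Qbox"
    using assms by (auto simp: Qpower_def PiE_iff space_PiM extensional_def)
  then show ?thesis by (auto simp: indicator_def)
qed

text \<open>Induction that integrates out the last factor. The function \<open>h\<close> is
  generalised because the hypothesis is applied to an average of right translates of
  \<open>h\<close>.\<close>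

lemma nn_integral_hprod:
  assumes "1 \<le> n" and "h \<in> borel_measurable borel"
  shows "(\<integral>\<^sup>+z. h (hprod n z) * indicator (Qpower n) z \<partial>PiM {1..n} (\<lambda>_. lborel)) =
    ennreal (sqrt 2 ^ n) * (\<integral>\<^sup>+p. h p * ennreal (real_bspline n p) \<partial>lborel)"
  using assms
proof (induction n arbitrary: h rule: dec_induct)
  case base
  interpret product_sigma_finite "\<lambda>_::nat. lborel :: heis measure" by standard
  note [measurable] = base
  have "(\<integral>\<^sup>+z. h (hprod 1 z) * indicator (Qpower 1) z \<partial>PiM {1::nat} (\<lambda>_. lborel)) =
      (\<integral>\<^sup>+z. h (z 1) * indicator Qbox (z 1) \<partial>PiM {1::nat} (\<lambda>_. lborel))"
    by (intro nn_integral_cong)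
       (auto simp: Qpower_def indicator_def hmult_zero PiE_iff space_PiM)
  also have "\<dots> = (\<integral>\<^sup>+p. h p * indicator Qbox p \<partial>lborel)"
    by (rule product_nn_integral_singleton) measurable
  also have "\<dots> = (\<integral>\<^sup>+p. ennreal (sqrt 2) * (h p * ennreal (real_bspline 1 p)) \<partial>lborel)"
    by (intro nn_integral_cong)
       (auto simp: real_bspline_1 indicator_def mult.left_commute ennreal_mult'[symmetric])
  also have "\<dots> = ennreal (sqrt 2) * (\<integral>\<^sup>+p. h p * ennreal (real_bspline 1 p) \<partial>lborel)"
    by (rule nn_integral_cmult) measurable
  finally show ?case by simp
next
  case (step n)
  interpret product_sigma_finite "\<lambda>_::nat. lborel :: heis measure" by standard
  note [measurable] = step.prems
  let ?P = "PiM {1..n} (\<lambda>_. lborel :: heis measure)"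
  let ?b = "\<lambda>p. ennreal (real_bspline n p)"
  have ins: "{1..Suc n} = insert (Suc n) {1..n}" by auto
  have [measurable]: "hprod n \<in> borel_measurable ?P" by measurable
  \<comment> \<open>Split off the coordinate \<open>Suc n\<close> as the variable \<open>w\<close>;
    the product of the first \<open>n\<close> factors does not see it.\<close>
  have "(\<integral>\<^sup>+z. h (hprod (Suc n) z) * indicator (Qpower (Suc n)) z \<partial>PiM {1..Suc n} (\<lambda>_. lborel)) =
      (\<integral>\<^sup>+z. \<integral>\<^sup>+w. h (hprod (Suc n) (z(Suc n := w))) *
        indicator (Qpower (Suc n)) (z(Suc n := w)) \<partial>lborel \<partial>?P)"
    unfolding ins
  proof (rule product_nn_integral_insert)
    have "(\<lambda>z. h (hprod (Suc n) z) * indicator (Qpower (Suc n)) z)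
        \<in> borel_measurable (PiM {1..Suc n} (\<lambda>_. lborel))"
      using hprod_measurable[of "Suc n" "{1..Suc n}"] by measurable
    then show "(\<lambda>z. h (hprod (Suc n) z) * indicator (Qpower (Suc n)) z)
        \<in> borel_measurable (PiM (insert (Suc n) {1..n}) (\<lambda>_. lborel))"
      by (simp only: ins)
  qed auto
  also have "\<dots> = (\<integral>\<^sup>+z. \<integral>\<^sup>+w. h (hprod n z \<cdot>\<^sub>H w) *
      (indicator (Qpower n) z * indicator Qbox w) \<partial>lborel \<partial>?P)"
  proof (intro nn_integral_cong)
    fix z w assume z: "z \<in> space ?P"
    have "hprod n (z(Suc n := w)) = hprod n z" by (rule hprod_cong) auto
    then show "h (hprod (Suc n) (z(Suc n := w))) * indicator (Qpower (Suc n)) (z(Suc n := w)) =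
        h (hprod n z \<cdot>\<^sub>H w) * (indicator (Qpower n) z * indicator Qbox w)"
      using indicator_Qpower_Suc[OF z] by simp
  qed
  also have "\<dots> = (\<integral>\<^sup>+z. (\<integral>\<^sup>+w. h (hprod n z \<cdot>\<^sub>H w) * indicator Qbox w \<partial>lborel) *
      indicator (Qpower n) z \<partial>?P)"
    by (subst nn_integral_multc[symmetric])
       (auto simp: mult_ac intro!: nn_integral_cong)
  \<comment> \<open>The induction hypothesis, with the integral of
    \<open>h (p \<cdot>\<^sub>H w)\<close> over \<open>w\<close> in \<open>Qbox\<close> in the role
    of \<open>h p\<close>.\<close>
  also have "\<dots> = ennreal (sqrt 2 ^ n) *
      (\<integral>\<^sup>+p. (\<integral>\<^sup>+w. h (p \<cdot>\<^sub>H w) * indicator Qbox w \<partial>lborel) * ?b p \<partial>lborel)"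
    by (rule step.IH) measurable
  also have "(\<integral>\<^sup>+p. (\<integral>\<^sup>+w. h (p \<cdot>\<^sub>H w) * indicator Qbox w \<partial>lborel) * ?b p \<partial>lborel) =
      (\<integral>\<^sup>+p. \<integral>\<^sup>+w. h (p \<cdot>\<^sub>H w) * ?b p * indicator Qbox w \<partial>lborel \<partial>lborel)"
    by (subst nn_integral_multc[symmetric])
       (auto simp: mult_ac intro!: nn_integral_cong)
  also have "\<dots> = (\<integral>\<^sup>+w. \<integral>\<^sup>+p. h (p \<cdot>\<^sub>H w) * ?b p * indicator Qbox w \<partial>lborel \<partial>lborel)"
    by (rule lborel_pair.Fubini') measurable
  \<comment> \<open>For fixed \<open>w\<close>, right invariance moves \<open>w\<close> from
    \<open>h\<close> to the spline, where it appears inverted exactly as in the convolution.\<close>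
  also have "\<dots> = (\<integral>\<^sup>+w. \<integral>\<^sup>+p. h p * ?b (p \<cdot>\<^sub>H hinv w) * indicator Qbox w \<partial>lborel \<partial>lborel)"
  proof (rule nn_integral_cong)
    fix w
    show "(\<integral>\<^sup>+p. h (p \<cdot>\<^sub>H w) * ?b p * indicator Qbox w \<partial>lborel) =
        (\<integral>\<^sup>+p. h p * ?b (p \<cdot>\<^sub>H hinv w) * indicator Qbox w \<partial>lborel)"
      using nn_integral_right_translate
        [of "\<lambda>p. h p * ?b (p \<cdot>\<^sub>H hinv w) * indicator Qbox w" w]
      by (simp add: hmult_assoc hmult_hinv hmult_zero)
  qed
  also have "\<dots> = (\<integral>\<^sup>+p. \<integral>\<^sup>+w. h p * ?b (p \<cdot>\<^sub>H hinv w) * indicator Qbox w \<partial>lborel \<partial>lborel)"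
    by (rule lborel_pair.Fubini') measurable
  \<comment> \<open>The \<open>w\<close>-integral is the convolution with \<open>bspline1\<close> up
    to its normalisation \<open>1 / sqrt 2\<close>; compensating for it gives one factor
    \<open>sqrt 2\<close> per order.\<close>
  also have "\<dots> = (\<integral>\<^sup>+p. ennreal (sqrt 2) * (h p * ennreal (real_bspline (Suc n) p)) \<partial>lborel)"
  proof (rule nn_integral_cong)
    fix p
    have "ennreal (sqrt 2) * (h p * ennreal (real_bspline (Suc n) p)) =
        (\<integral>\<^sup>+w. (ennreal (sqrt 2) * h p) *
          (?b (p \<cdot>\<^sub>H hinv w) * (ennreal (1 / sqrt 2) * indicator Qbox w)) \<partial>lborel)"
      unfolding real_bspline_Suc[OF step.hyps(1)]
      by (subst nn_integral_cmult) (auto simp: mult.assoc)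
    also have "\<dots> = (\<integral>\<^sup>+w. (ennreal (sqrt 2) * ennreal (1 / sqrt 2)) *
          (h p * ?b (p \<cdot>\<^sub>H hinv w) * indicator Qbox w) \<partial>lborel)"
      by (simp only: mult_ac)
    also have "ennreal (sqrt 2) * ennreal (1 / sqrt 2) = 1"
      by (simp add: ennreal_mult'[symmetric])
    finally show "(\<integral>\<^sup>+w. h p * ?b (p \<cdot>\<^sub>H hinv w) * indicator Qbox w \<partial>lborel) =
        ennreal (sqrt 2) * (h p * ennreal (real_bspline (Suc n) p))" by simp
  qed
  also have "\<dots> = ennreal (sqrt 2) * (\<integral>\<^sup>+p. h p * ennreal (real_bspline (Suc n) p) \<partial>lborel)"
    by (rule nn_integral_cmult) measurable
  finally show ?case by (simp add: ennreal_mult' mult.left_commute mult.assoc mult.commute)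
qed

text \<open>Testing \<open>nn_integral_hprod\<close> on indicators of Borel sets gives an identity
  of measures, through which complex integrals and almost everywhere statements can be
  transported.\<close>

lemma distr_hprod:
  assumes "1 \<le> n"
  shows "distr (density (PiM {1..n} (\<lambda>_. lborel)) (indicator (Qpower n))) borel (hprod n) =
    density lborel (\<lambda>p. ennreal (sqrt 2 ^ n * real_bspline n p))" (is "?L = ?R")
proof (rule measure_eqI)
  fix A assume "A \<in> sets ?L"
  then have [measurable]: "A \<in> sets borel" by simp
  have [measurable]: "hprod n \<in> borel_measurable (PiM {1..n} (\<lambda>_. lborel))" by measurable
  have "emeasure ?L A = (\<integral>\<^sup>+p. indicator A p \<partial>?L)" by simp
  also have "\<dots> = (\<integral>\<^sup>+z. indicator A (hprod n z) \<partial>density (PiM {1..n} (\<lambda>_. lborel)) (indicator (Qpower n)))"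
    by (rule nn_integral_distr) measurable
  also have "\<dots> = (\<integral>\<^sup>+z. indicator A (hprod n z) * indicator (Qpower n) z \<partial>PiM {1..n} (\<lambda>_. lborel))"
    by (subst nn_integral_density) (auto simp: mult.commute simp del: One_nat_def)
  also have "\<dots> = ennreal (sqrt 2 ^ n) * (\<integral>\<^sup>+p. indicator A p * ennreal (real_bspline n p) \<partial>lborel)"
    by (rule nn_integral_hprod[OF assms]) measurable
  also have "\<dots> = (\<integral>\<^sup>+p. ennreal (sqrt 2 ^ n * real_bspline n p) * indicator A p \<partial>lborel)"
    by (subst nn_integral_cmult[symmetric]) (auto simp: ennreal_mult' mult_ac intro!: nn_integral_cong)
  also have "\<dots> = emeasure ?R A" by (simp add: emeasure_density)
  finally show "emeasure ?L A = emeasure ?R A" .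
qed simp

section \<open>Integration against splines\<close>

text \<open>The spline is bounded, so a constant multiple of \<open>f\<close> dominates.\<close>

lemma integrable_mult_real_bspline:
  fixes f :: "heis \<Rightarrow> complex"
  assumes f: "integrable lborel f" and n: "1 \<le> n"
  shows "integrable lborel (\<lambda>p. real_bspline n p *\<^sub>R f p)"
proof -
  obtain C where C: "\<And>p. real_bspline n p \<le> C" using real_bspline_bounded[OF n] by blast
  have b0: "\<And>p. 0 \<le> real_bspline n p" using real_bspline_nonneg[OF n] .
  have [measurable]: "f \<in> borel_measurable borel" using borel_measurable_integrable[OF f] by simp
  have "integrable lborel (\<lambda>p. C *\<^sub>R f p)" using f by simp
  then show ?thesis
  proof (rule Bochner_Integration.integrable_bound)
    have "0 \<le> C" using b0 C order_trans by blast
    then show "AE p in lborel. norm (real_bspline n p *\<^sub>R f p) \<le> norm (C *\<^sub>R f p)"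
      using b0 C by (auto intro!: mult_right_mono)
  qed measurable
qed

text \<open>Both sides integrate \<open>f\<close> against the single measure of
  \<open>distr_hprod\<close>, read once as a push-forward and once as a density.\<close>

lemma integral_hprod_borel:
  fixes f :: "heis \<Rightarrow> complex"
  assumes f: "integrable lborel f" and n: "1 \<le> n"
  shows "integrable (PiM {1..n} (\<lambda>_. lborel)) (\<lambda>z. indicator (Qpower n) z *\<^sub>R f (hprod n z))"
    and "(LINT z|PiM {1..n} (\<lambda>_. lborel). indicator (Qpower n) z *\<^sub>R f (hprod n z)) =
      sqrt 2 ^ n *\<^sub>R (LINT p|lborel. real_bspline n p *\<^sub>R f p)"
proof -
  let ?P = "PiM {1..n} (\<lambda>_. lborel :: heis measure)"
  \<comment> \<open>The indicator is written as a coerced real function because the Bochner rules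
    for densities expect that form.\<close>
  let ?D = "density ?P (\<lambda>z. ennreal (indicator (Qpower n) z))"
  have [measurable]: "f \<in> borel_measurable borel" using borel_measurable_integrable[OF f] by simp
  have [measurable]: "hprod n \<in> borel_measurable ?P" by measurable
  have hD: "hprod n \<in> ?D \<rightarrow>\<^sub>M borel" by simp
  have D: "distr ?D borel (hprod n) = density lborel (\<lambda>p. ennreal (sqrt 2 ^ n * real_bspline n p))"
    using distr_hprod[OF n] by (simp add: ennreal_indicator)
  have nonneg: "0 \<le> sqrt 2 ^ n * real_bspline n p" for p
    using real_bspline_nonneg[OF n] by simp
  have "integrable lborel (\<lambda>p. (sqrt 2 ^ n * real_bspline n p) *\<^sub>R f p)"
    using integrable_mult_real_bspline[OF f n]
    by (simp only: scaleR_scaleR[symmetric] integrable_scaleR_right)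
  then have "integrable (distr ?D borel (hprod n)) f"
    unfolding D by (subst integrable_density) (use nonneg in auto)
  then have "integrable ?D (\<lambda>z. f (hprod n z))"
    by (rule integrable_distr[OF hD])
  then show "integrable ?P (\<lambda>z. indicator (Qpower n) z *\<^sub>R f (hprod n z))"
    by (subst (asm) integrable_density) (auto simp del: One_nat_def)
  have "(LINT z|?P. indicator (Qpower n) z *\<^sub>R f (hprod n z)) = (LINT z|?D. f (hprod n z))"
    by (rule integral_density[symmetric]) (auto simp del: One_nat_def)
  also have "\<dots> = (LINT p|distr ?D borel (hprod n). f p)"
    by (rule integral_distr[OF hD, symmetric]) measurable
  also have "\<dots> = (LINT p|lborel. (sqrt 2 ^ n * real_bspline n p) *\<^sub>R f p)"
    unfolding D by (rule integral_density) (use nonneg in auto)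
  finally show "(LINT z|?P. indicator (Qpower n) z *\<^sub>R f (hprod n z)) =
      sqrt 2 ^ n *\<^sub>R (LINT p|lborel. real_bspline n p *\<^sub>R f p)"
    by (simp only: scaleR_scaleR[symmetric] integral_scaleR_right)
qed

text \<open>The push-forward has a density with respect to \<open>lborel\<close>, so it inherits the
  null sets, and these pull back along \<open>hprod n\<close>.\<close>

lemma AE_hprod:
  assumes n: "1 \<le> n" and ae: "AE p in lborel. P p"
  shows "AE z in PiM {1..n} (\<lambda>_. lborel). z \<in> Qpower n \<longrightarrow> P (hprod n z)"
proof -
  let ?D = "density (PiM {1..n} (\<lambda>_. lborel :: heis measure)) (indicator (Qpower n))"
  have [measurable]: "hprod n \<in> borel_measurable (PiM {1..n} (\<lambda>_. lborel))" by measurable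
  have "AE p in distr ?D borel (hprod n). P p"
    unfolding distr_hprod[OF n] by (subst AE_density) (use ae in auto)
  then have "AE z in ?D. P (hprod n z)"
    by (rule AE_distrD[rotated]) simp
  then show ?thesis
    by (subst (asm) AE_density) (auto simp: indicator_def simp del: One_nat_def)
qed

section \<open>Measurability and almost everywhere equality in completions\<close>

lemma measurable_completion_cong_AE:
  assumes f: "f \<in> completion M \<rightarrow>\<^sub>M N" and ae: "AE x in M. f x = g x"
    and g: "g \<in> space M \<rightarrow> space N"
  shows "g \<in> completion M \<rightarrow>\<^sub>M N"
proof (rule measurableI)
  fix A assume "A \<in> sets N"
  show "g -` A \<inter> space (completion M) \<in> sets (completion M)"
  \<comment> \<open>The preimages under \<open>f\<close> and \<open>g\<close> differ only in a null
    set, and a complete measure space contains any set that agrees almost everywhere with a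
    measurable one.\<close>
  proof (rule completion.in_sets_AE)
    show "f -` A \<inter> space (completion M) \<in> sets (completion M)"
      using f \<open>A \<in> sets N\<close> by (rule measurable_sets)
    show "AE x in completion M. x \<in> f -` A \<inter> space (completion M) \<longleftrightarrow>
        x \<in> g -` A \<inter> space (completion M)"
      using AE_completion[OF ae] by eventually_elim auto
  qed auto
qed (use g in auto)

text \<open>Real and imaginary parts are replaced separately, and the union of the two exceptional
  sets is still null.\<close>

lemma completion_ex_borel_measurable_complex:
  fixes f :: "'a \<Rightarrow> complex"
  assumes "f \<in> borel_measurable (completion M)"
  shows "\<exists>g\<in>borel_measurable M. AE x in M. f x = g x"
proof -
  have "(\<lambda>x. Re (f x)) \<in> borel_measurable (completion M)"
    "(\<lambda>x. Im (f x)) \<in> borel_measurable (completion M)"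
    using assms by (simp_all add: borel_measurable_complex_iff)
  then obtain u v where uv: "u \<in> borel_measurable M" "v \<in> borel_measurable M"
    and "AE x in M. Re (f x) = u x" "AE x in M. Im (f x) = v x"
    using completion_ex_borel_measurable_real by metis
  then have "AE x in M. f x = Complex (u x) (v x)"
    by (auto simp: complex_eq_iff)
  moreover have "(\<lambda>x. Complex (u x) (v x)) \<in> borel_measurable M"
    unfolding borel_measurable_complex_iff complex.sel using uv ..
  ultimately show ?thesis by (rule bexI)
qed

text \<open>The integrability claims ensure that neither integral is the default value 0 of a
  divergent one.\<close>

theorem theorem3p1:
  fixes f :: "heis \<Rightarrow> complex" and n :: nat
  assumes "integrable lebesgue f" and "n \<ge> 2"
  shows "integrable lebesgue (\<lambda>p. f p * bspline n p) \<and>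
    set_integrable (lebesgue_power n) (Qpower n) (\<lambda>z. iter_rtrans n z f (z 1)) \<and>
    (LINT p|lebesgue. f p * bspline n p) =
      complex_of_real (1 / sqrt 2 ^ n) *
        (LINT z:Qpower n|lebesgue_power n. iter_rtrans n z f (z 1))"
proof -
  let ?P = "PiM {1..n} (\<lambda>_. lborel :: heis measure)"
  have n: "1 \<le> n" using assms by simp
  have mf: "f \<in> borel_measurable lebesgue" using assms(1) by (rule borel_measurable_integrable)
  \<comment> \<open>A Borel representative \<open>g\<close> of \<open>f\<close>; the formula is
    proved for \<open>g\<close> and then carried back to \<open>f\<close>.\<close>
  obtain g where mg: "g \<in> borel_measurable lborel" and fg: "AE p in lborel. f p = g p"
    using completion_ex_borel_measurable_complex[OF mf] by blast
  have fg': "AE p in lebesgue. f p = g p" using fg by (rule AE_completion)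
  have "integrable lebesgue g"
    by (rule integrable_cong_AE_imp[OF assms(1) measurable_completion[OF mg]])
       (use fg' in \<open>auto elim: eventually_mono\<close>)
  then have ig: "integrable lborel g" using mg by (simp add: integrable_completion)

  \<comment> \<open>\<open>b\<close> is the Borel substitute for the integrand on the left;
    integrability and the value of the integral transfer along \<open>fb\<close>.\<close>
  define b where "b p = real_bspline n p *\<^sub>R g p" for p
  have ib: "integrable lborel b"
    using integrable_mult_real_bspline[OF ig n] by (simp add: b_def[abs_def])
  have mb: "b \<in> borel_measurable lborel" using ib by (rule borel_measurable_integrable)
  have fb: "AE p in lborel. b p = f p * bspline n p"
    using fg by eventually_elim (simp add: b_def bspline_eq_real[OF n] scaleR_conv_of_real)
  have mfb: "(\<lambda>p. f p * bspline n p) \<in> borel_measurable lebesgue"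
    by (rule measurable_completion_cong_AE[OF measurable_completion[OF mb] fb]) simp
  have ifb: "integrable lebesgue (\<lambda>p. f p * bspline n p)"
    using ib mb by (intro integrable_cong_AE_imp[OF _ mfb AE_completion[OF fb]])
      (simp add: integrable_completion)
  have "(LINT p|lebesgue. f p * bspline n p) = integral\<^sup>L lebesgue b"
    using AE_completion[OF fb]
    by (intro integral_cong_AE mfb measurable_completion[OF mb]) (auto elim: eventually_mono)
  also have "\<dots> = integral\<^sup>L lborel b"
    by (rule integral_completion[OF mb])
  finally have efb: "(LINT p|lebesgue. f p * bspline n p) = integral\<^sup>L lborel b" .

  \<comment> \<open>The integrands on the right for \<open>g\<close> and for \<open>f\<close>.
    \<open>G\<close> is measurable for the product sigma-algebra; \<open>F\<close> is shown
    measurable for its completion, as it equals \<open>G\<close> almost everywhere by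
    \<open>AE_hprod\<close>.\<close>
  define G where "G z = indicator (Qpower n) z *\<^sub>R g (hprod n z)" for z
  define F where "F z = indicator (Qpower n) z *\<^sub>R f (hprod n z)" for z
  have iG: "integrable ?P G" and eG: "integral\<^sup>L ?P G = sqrt 2 ^ n *\<^sub>R integral\<^sup>L lborel b"
    using integral_hprod_borel[OF ig n] by (simp_all add: G_def[abs_def] b_def[abs_def])
  have mG: "G \<in> borel_measurable ?P" using iG by (rule borel_measurable_integrable)
  have FG: "AE z in ?P. G z = F z"
    using AE_hprod[OF n fg] by eventually_elim (auto simp: G_def F_def indicator_def)
  have mF: "F \<in> borel_measurable (completion ?P)"
    by (rule measurable_completion_cong_AE[OF measurable_completion[OF mG] FG]) simp
  have iF: "integrable (completion ?P) F"
    using iG mG by (intro integrable_cong_AE_imp[OF _ mF AE_completion[OF FG]])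
      (simp add: integrable_completion)
  have "integral\<^sup>L (completion ?P) F = integral\<^sup>L (completion ?P) G"
    using AE_completion[OF FG]
    by (intro integral_cong_AE mF measurable_completion[OF mG]) (auto elim: eventually_mono)
  also have "\<dots> = integral\<^sup>L ?P G"
    by (rule integral_completion[OF mG])
  finally have eF: "integral\<^sup>L (completion ?P) F = sqrt 2 ^ n *\<^sub>R integral\<^sup>L lborel b"
    using eG by simp

  have F: "F = (\<lambda>z. indicator (Qpower n) z *\<^sub>R iter_rtrans n z f (z 1))"
    by (simp only: F_def[abs_def] iter_rtrans_eq_hprod[OF n])
  \<comment> \<open>Both sides are now multiples of the integral of \<open>b\<close>, and
    \<open>1 / sqrt 2 ^ n\<close> cancels the factor \<open>sqrt 2 ^ n\<close> in
    \<open>eF\<close>.\<close>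
  show ?thesis
    unfolding set_integrable_def set_lebesgue_integral_def lebesgue_power_def F[symmetric] efb eF
    using ifb iF by (simp add: scaleR_conv_of_real)
qed

end
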